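(* Let $\mathbb{B}_0=(X_1,X_2,X_3)$ be the basis of the Lie algebra $\mathfrak{sol}$ of $\mathrm{Sol}$ with $[X_1,X_2]=X_2$, $[X_1,X_3]=-X_3$, $[X_2,X_3]=0$. Let $u>0$ and consider the left invariant metric on $\mathrm{Sol}$ with matrix $\mathrm{diag}\left(\frac1u,-1,1\right)$ in $\mathbb{B}_0$. Its Ricci curvature and scalar curvature are $$M(\mathrm{ric},\mathbb{B}_0)=\begin{pmatrix}-2&0&0\\0&0&0\\0&0&0\end{pmatrix},\qquad\mathfrak{s}=-2u.$$
   Context: $\mathrm{Sol}$ is the simply connected Lie group with Lie algebra $\mathfrak{sol}$. A left invariant metric on a Lie group with Lie algebra $\mathfrak{g}$ is identified with a nondegenerate symmetric bilinear form $\langle\,,\rangle$ on $\mathfrak{g}$. The Levi-Civita product $\mathrm{L}:\mathfrak{g}\times\mathfrak{g}\to\mathfrak{g}$ is given by $2\langle\mathrm{L}_uv,w\rangle=\langle[u,v],w\rangle+\langle[w,u],v\rangle+\langle[w,v],u\rangle$, the curvature by $\mathrm{K}(u,v)=\mathrm{L}_{[u,v]}-[\mathrm{L}_u,\mathrm{L}_v]$, the Ricci tensor by $\mathrm{ric}(u,v)=\mathrm{tr}(w\mapsto\mathrm{K}(u,w)v)$, the Ricci operator by $\langle\mathrm{Ric}(u),v\rangle=\mathrm{ric}(u,v)$, and the scalar curvature by $\mathfrak{s}=\mathrm{tr}(\mathrm{Ric})$. $M(\mathrm{ric},\mathbb{B}_0)$ is the Gram matrix of $\mathrm{ric}$ in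 $\mathbb{B}_0$. *)

theory Defs
  imports "HOL-Analysis.Analysis"
begin

text \<open>
  A real Lie algebra of dimension \<open>n\<close> is a Lie bracket on the vector space \<open>\<real>\<^sup>n\<close>. The inner product
  and the standard basis of \<open>\<real>\<^sup>n\<close> play no role other than in computing the (basis independent)
  trace of an endomorphism as \<open>trace (matrix f)\<close>.
\<close>

definition lie_bracket :: "('a::real_vector \<Rightarrow> 'a \<Rightarrow> 'a) \<Rightarrow> bool" where
  "lie_bracket br \<longleftrightarrow> bilinear br \<and> (\<forall>x. br x x = 0) \<and>
     (\<forall>x y z. br x (br y z) + br y (br z x) + br z (br x y) = 0)"

text \<open>Left invariant metrics are pseudo-Riemannian: no definiteness is required.\<close>

definition lie_metric :: "('a::real_vector \<Rightarrow> 'a \<Rightarrow> real) \<Rightarrow> bool" where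
  "lie_metric g \<longleftrightarrow> bilinear g \<and> (\<forall>x y. g x y = g y x) \<and> (\<forall>x. (\<forall>y. g x y = 0) \<longrightarrow> x = 0)"

definition basis_family :: "('n::finite \<Rightarrow> 'a::real_vector) \<Rightarrow> bool" where
  "basis_family X \<longleftrightarrow> inj X \<and> independent (range X) \<and> span (range X) = UNIV"

definition gram_matrix :: "('a \<Rightarrow> 'a \<Rightarrow> real) \<Rightarrow> ('n::finite \<Rightarrow> 'a) \<Rightarrow> real^'n^'n" where
  "gram_matrix b X = (\<chi> i j. b (X i) (X j))"

text \<open>In finite dimension, the definite descriptions here and in the Ricci operator denote a unique
  vector whenever \<open>g\<close> is a metric and \<open>br\<close> is bilinear.\<close>

definition levi_civita ::
  "('a::real_vector \<Rightarrow> 'a \<Rightarrow> 'a) \<Rightarrow> ('a \<Rightarrow> 'a \<Rightarrow> real) \<Rightarrow> 'a \<Rightarrow> 'a \<Rightarrow> 'a" where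
  "levi_civita br g u v =
     (THE x. \<forall>w. 2 * g x w = g (br u v) w + g (br w u) v + g (br w v) u)"

text \<open>The sign convention is \<open>K(u,v) = L\<^bsub>[u,v]\<^esub> - [L\<^sub>u, L\<^sub>v]\<close>.\<close>

definition curvature ::
  "('a::real_vector \<Rightarrow> 'a \<Rightarrow> 'a) \<Rightarrow> ('a \<Rightarrow> 'a \<Rightarrow> real) \<Rightarrow> 'a \<Rightarrow> 'a \<Rightarrow> 'a \<Rightarrow> 'a" where
  "curvature br g u v w =
     levi_civita br g (br u v) w
     - (levi_civita br g u (levi_civita br g v w) - levi_civita br g v (levi_civita br g u w))"

definition ric ::
  "(real^'n \<Rightarrow> real^'n \<Rightarrow> real^'n) \<Rightarrow> (real^'n \<Rightarrow> real^'n \<Rightarrow> real)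
     \<Rightarrow> real^'n \<Rightarrow> real^'n \<Rightarrow> real" where
  "ric br g u v = trace (matrix (\<lambda>w. curvature br g u w v))"

definition ricci_operator ::
  "(real^'n \<Rightarrow> real^'n \<Rightarrow> real^'n) \<Rightarrow> (real^'n \<Rightarrow> real^'n \<Rightarrow> real) \<Rightarrow> real^'n \<Rightarrow> real^'n" where
  "ricci_operator br g u = (THE x. \<forall>v. g x v = ric br g u v)"

definition scalar_curvature ::
  "(real^'n \<Rightarrow> real^'n \<Rightarrow> real^'n) \<Rightarrow> (real^'n \<Rightarrow> real^'n \<Rightarrow> real) \<Rightarrow> real" where
  "scalar_curvature br g = trace (matrix (ricci_operator br g))"

end

theory Submission
  imports Defs
begin

text \<open>
  Write \<open>x\<^sub>i\<close> for the coordinates in \<open>X\<close>. Koszul's formula gives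
  \<open>L\<^sub>x y = - u (x\<^sub>2 y\<^sub>2 + x\<^sub>3 y\<^sub>3) X\<^sub>1 - x\<^sub>2 y\<^sub>1 X\<^sub>2 + x\<^sub>3 y\<^sub>1 X\<^sub>3\<close>. Traces may be computed in the basis
  \<open>X\<close>, so \<open>ric x y = - 2 x\<^sub>1 y\<^sub>1\<close>, and the Ricci operator is \<open>x \<mapsto> - 2 u x\<^sub>1 X\<^sub>1\<close>.
\<close>

text \<open>For a basis family \<open>X\<close> this is the dual basis.
  \<open>representation\<close> is indexed by the vectors of \<open>range X\<close>; injectivity of
  \<open>X\<close> lets the index type label the coordinates instead.\<close>

definition coord :: "('n::finite \<Rightarrow> 'a::real_vector) \<Rightarrow> 'n \<Rightarrow> 'a \<Rightarrow> real" where
  "coord X i x = representation (range X) x (X i)"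

lemma linear_coord:
  assumes "basis_family X"
  shows "linear (coord X i)"
  using assms unfolding basis_family_def coord_def
  by (intro linearI) (simp_all add: representation_add representation_scale)

lemma coord_basis:
  assumes "basis_family X"
  shows "coord X i (X j) = (if i = j then 1 else 0)"
  using assms unfolding basis_family_def coord_def
  by (auto simp: representation_basis inj_eq)

lemma coord_expansion:
  assumes "basis_family X"
  shows "(\<Sum>i\<in>UNIV. coord X i x *\<^sub>R X i) = x"
proof -
  have "(\<Sum>b\<in>range X. representation (range X) x b *\<^sub>R b) = x"
    using assms by (intro real_vector.sum_representation_eq) (auto simp: basis_family_def)
  then show ?thesis
    using assms by (simp add: sum.reindex basis_family_def coord_def)
qed

lemma bilinear_expansion:
  assumes "basis_family X" and "bilinear b"
  shows "b x y = (\<Sum>i\<in>UNIV. \<Sum>j\<in>UNIV. (coord X i x * coord X j y) *\<^sub>R b (X i) (X j))"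
proof -
  have "b x y = b (\<Sum>i\<in>UNIV. coord X i x *\<^sub>R X i) (\<Sum>j\<in>UNIV. coord X j y *\<^sub>R X j)"
    by (simp only: coord_expansion[OF assms(1)])
  also have "\<dots> = (\<Sum>(i,j)\<in>UNIV\<times>UNIV. b (coord X i x *\<^sub>R X i) (coord X j y *\<^sub>R X j))"
    by (rule bilinear_sum[OF assms(2)])
  also have "\<dots> = (\<Sum>i\<in>UNIV. \<Sum>j\<in>UNIV. (coord X i x * coord X j y) *\<^sub>R b (X i) (X j))"
    by (simp add: sum.cartesian_product bilinear_lmul[OF assms(2)] bilinear_rmul[OF assms(2)]
        mult.commute)
  finally show ?thesis .
qed

text \<open>Expanding each standard basis vector in \<open>X\<close> turns the diagonal entries of
  \<open>matrix f\<close> into a double sum. After swapping the sums, the inner one reassembles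
  \<open>f (X i)\<close> from its standard coordinates.\<close>

lemma trace_matrix_coord:
  fixes f :: "real^'n \<Rightarrow> real^'n"
  assumes X: "basis_family X" and f: "linear f"
  shows "trace (matrix f) = (\<Sum>i\<in>UNIV. coord X i (f (X i)))"
proof -
  have "f (axis k 1) $ k = (\<Sum>i\<in>UNIV. coord X i (axis k 1) * f (X i) $ k)" for k
  proof -
    have "f (axis k 1) = f (\<Sum>i\<in>UNIV. coord X i (axis k 1) *\<^sub>R X i)"
      by (simp only: coord_expansion[OF X])
    then show ?thesis
      by (simp add: linear_sum[OF f] linear_cmul[OF f])
  qed
  then have "trace (matrix f) = (\<Sum>k\<in>UNIV. \<Sum>i\<in>UNIV. coord X i (axis k 1) * f (X i) $ k)"
    by (simp add: trace_def matrix_def)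
  also have "\<dots> = (\<Sum>i\<in>UNIV. \<Sum>k\<in>UNIV. f (X i) $ k *\<^sub>R coord X i (axis k 1))"
    by (subst sum.swap) (simp add: mult.commute)
  also have "\<dots> = (\<Sum>i\<in>UNIV. coord X i (\<Sum>k\<in>UNIV. f (X i) $ k *\<^sub>R axis k 1))"
    by (simp add: linear_sum[OF linear_coord[OF X]] linear_cmul[OF linear_coord[OF X]])
  also have "\<dots> = (\<Sum>i\<in>UNIV. coord X i (f (X i)))"
    using basis_expansion[of "f (X i)" for i] by (simp add: scalar_mult_eq_scaleR)
  finally show ?thesis .
qed

text \<open>Nondegeneracy applied to \<open>x - y\<close>. This gives the uniqueness behind both
  definite descriptions, so that it suffices to exhibit a vector with the defining property.\<close>

lemma lie_metric_inject:
  assumes "lie_metric g" and "\<And>w. g x w = g y w"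
  shows "x = y"
proof -
  have "bilinear g"
    using assms(1) by (simp add: lie_metric_def)
  then have "g (x - y) w = 0" for w
    using assms(2) by (simp add: bilinear_lsub)
  then show ?thesis
    using assms(1) unfolding lie_metric_def by (metis eq_iff_diff_eq_0)
qed

lemma levi_civita_eqI:
  assumes "lie_metric g"
    and "\<And>w. 2 * g z w = g (br x y) w + g (br w x) y + g (br w y) x"
  shows "levi_civita br g x y = z"
  unfolding levi_civita_def
proof (rule the_equality)
  fix z' assume "\<forall>w. 2 * g z' w = g (br x y) w + g (br w x) y + g (br w y) x"
  with assms(2) have "2 * g z' w = 2 * g z w" for w by simp
  then show "z' = z" by (intro lie_metric_inject[OF assms(1)]) simp
qed (use assms(2) in blast)

lemma ricci_operator_eqI:
  assumes "lie_metric g" and "\<And>v. g z v = ric br g x v"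
  shows "ricci_operator br g x = z"
  unfolding ricci_operator_def
  using assms by (intro the_equality) (auto intro: lie_metric_inject)

locale sol_metric =
  fixes br :: "real^3 \<Rightarrow> real^3 \<Rightarrow> real^3"
    and g :: "real^3 \<Rightarrow> real^3 \<Rightarrow> real"
    and X :: "3 \<Rightarrow> real^3"
    and u :: real
  assumes bracket: "lie_bracket br"
    and basis: "basis_family X"
    and br12: "br (X 1) (X 2) = X 2"
    and br13: "br (X 1) (X 3) = - X 3"
    and br23: "br (X 2) (X 3) = 0"
    and u_pos: "u > 0"
    and metric: "lie_metric g"
    and gram: "gram_matrix g X =
           vector [vector [1 / u, 0, 0],
                   vector [0, - 1, 0],
                   vector [0, 0, 1]]"
begin

lemma br_skew: "br x y = - br y x"
proof -
  have bil: "bilinear br" and alt: "br z z = 0" for z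
    using bracket by (auto simp: lie_bracket_def)
  \<comment> \<open>Polarization: the terms \<open>br x x\<close> and \<open>br y y\<close> of the
    expanded right-hand side vanish.\<close>
  have "br x y + br y x = br (x + y) (x + y)"
    by (simp add: bilinear_ladd[OF bil] bilinear_radd[OF bil] alt[of x] alt[of y])
  then show ?thesis
    by (simp add: alt eq_neg_iff_add_eq_0)
qed

lemmas coord_simps =
  linear_add[OF linear_coord[OF basis]] linear_diff[OF linear_coord[OF basis]]
  linear_neg[OF linear_coord[OF basis]] linear_cmul[OF linear_coord[OF basis]]
  linear_0[OF linear_coord[OF basis]] coord_basis[OF basis]

lemma br_eq:
  "br x y = (coord X 1 x * coord X 2 y - coord X 2 x * coord X 1 y) *\<^sub>R X 2
     - (coord X 1 x * coord X 3 y - coord X 3 x * coord X 1 y) *\<^sub>R X 3"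
proof -
  have "bilinear br" and "br (X i) (X i) = 0" for i
    using bracket by (auto simp: lie_bracket_def)
  moreover have "br (X 2) (X 1) = - X 2" "br (X 3) (X 1) = X 3" "br (X 3) (X 2) = 0"
    using br_skew[of "X 2" "X 1"] br_skew[of "X 3" "X 1"] br_skew[of "X 3" "X 2"]
    by (simp_all add: br12 br13 br23)
  ultimately show ?thesis
    by (subst bilinear_expansion[OF basis])
      (simp_all add: sum_3 br12 br13 br23 scaleR_diff_left)
qed

lemma metric_eq:
  "g x y = coord X 1 x * coord X 1 y / u - coord X 2 x * coord X 2 y + coord X 3 x * coord X 3 y"
proof -
  have "bilinear g"
    using metric by (simp add: lie_metric_def)
  moreover have "g (X i) (X j) = gram_matrix g X $ i $ j" for i j
    by (simp add: gram_matrix_def)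
  ultimately show ?thesis
    by (subst bilinear_expansion[OF basis]) (simp_all add: sum_3 gram)
qed

text \<open>Both sides of Koszul's formula are compared in coordinates. The factor \<open>u\<close>
  in front of \<open>X 1\<close> inverts \<open>g (X 1) (X 1) = 1 / u\<close>. The squares of
  \<open>X 2\<close> and \<open>X 3\<close> get the same sign because these vectors differ in sign
  both in the metric and as eigenvectors of \<open>br (X 1)\<close>.\<close>

lemma levi_civita_eq:
  "levi_civita br g x y =
     (- u * (coord X 2 x * coord X 2 y + coord X 3 x * coord X 3 y)) *\<^sub>R X 1
     - (coord X 2 x * coord X 1 y) *\<^sub>R X 2 + (coord X 3 x * coord X 1 y) *\<^sub>R X 3"
  using u_pos
  by (intro levi_civita_eqI[OF metric]) (simp add: metric_eq br_eq coord_simps field_simps)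

text \<open>Linearity in the traced argument is what allows the Ricci trace to be computed in
  \<open>X\<close>.\<close>

lemma linear_curvature: "linear (\<lambda>w. curvature br g x w y)"
  by (rule linearI)
    (simp_all add: curvature_def levi_civita_eq br_eq coord_simps algebra_simps)

text \<open>Writing K for the curvature, K(X1,X2)X1 = -X2 and K(X1,X3)X1 = -X3 give ric(X1,X1) = -2.
  In ric(X2,X2) the contributions u of w = X1 and -u of w = X3 cancel; in ric(X3,X3) those of w = X1
  and w = X2 are -u and u.\<close>

lemma ric_eq: "ric br g x y = - 2 * coord X 1 x * coord X 1 y"
  unfolding ric_def trace_matrix_coord[OF basis linear_curvature]
  by (simp add: sum_3 curvature_def levi_civita_eq br_eq coord_simps algebra_simps)

lemma ricci_operator_eq: "ricci_operator br g x = (- 2 * u * coord X 1 x) *\<^sub>R X 1"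
  using u_pos
  by (intro ricci_operator_eqI[OF metric]) (simp add: metric_eq ric_eq coord_simps)

lemma gram_matrix_ric:
  "gram_matrix (ric br g) X =
     vector [vector [- 2, 0, 0], vector [0, 0, 0], vector [0, 0, 0]]"
  by (simp add: vec_eq_iff forall_3 gram_matrix_def ric_eq coord_simps)

lemma scalar_curvature_eq: "scalar_curvature br g = - 2 * u"
proof -
  \<comment> \<open>With linearity the trace can be taken in \<open>X\<close>, where the image lies
    on the line of \<open>X 1\<close>, so only the first diagonal entry survives.\<close>
  have "linear (ricci_operator br g)"
    by (rule linearI) (simp_all add: ricci_operator_eq coord_simps algebra_simps)
  then show ?thesis
    by (simp add: scalar_curvature_def trace_matrix_coord[OF basis] sum_3 ricci_operator_eq
        coord_simps)
qed

end

theorem proposition4p13: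
  fixes br :: "real^3 \<Rightarrow> real^3 \<Rightarrow> real^3"
    and g :: "real^3 \<Rightarrow> real^3 \<Rightarrow> real"
    and X :: "3 \<Rightarrow> real^3"
    and u :: real
  assumes "lie_bracket br"
    and "basis_family X"
    and "br (X 1) (X 2) = X 2"
    and "br (X 1) (X 3) = - X 3"
    and "br (X 2) (X 3) = 0"
    and "u > 0"
    and "lie_metric g"
    and "gram_matrix g X =
           vector [vector [1 / u, 0, 0],
                   vector [0, - 1, 0],
                   vector [0, 0, 1]]"
  shows "gram_matrix (ric br g) X =
           vector [vector [- 2, 0, 0],
                   vector [0, 0, 0],
                   vector [0, 0, 0]]
         \<and> scalar_curvature br g = - 2 * u"
proof -
  interpret sol_metric br g X u
    using assms by unfold_locales
  show ?thesis
    using gram_matrix_ric scalar_curvature_eq by blast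
qed

end
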